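(* Let $A,B,H,K$ be any logically independent events. A probability assessment $\mathcal{P}=(x,y,z)$ on the family of conditional events $\mathcal{F}=\{A|H,\ (B|K)|_{C}(A|H),\ (A|H)\wedge_{S}(B|K)\}$ is coherent if and only if $(x,y)\in[0,1]^2$ and $z\in[z',z'']$, where $z'=xy$ and $z''=\max(x,y)$.
   Context: Events are two-valued entities (true/false), identified with their indicators (values $1/0$). $\emptyset$ is the impossible event; $AB$ denotes $A\wedge B$; $\overline{A}$ is the negation of $A$. Four events are logically independent if all $16$ conjunctions obtained by taking each event or its negation are different from $\emptyset$. For events $E,H$ with $H\neq\emptyset$, the conditional event $E|H$ is true if $EH$ is true, false if $\overline{E}H$ is true, void if $\overline{H}$ is true. Coherence: a real vector $\mathcal{P}=(p_1,\dots,p_n)$, with $p_j=P(E_j|H_j)$, on $\mathcal{F}=\{E_1|H_1,\dots,E_n|H_n\}$ is coherent iff for every nonempty $J\subseteq\{1,\dots,n\}$ and all real numbers $s_j$ ($j\in J$), the random gain $G=\sum_{j\in J}s_jH_j(E_j-p_j)$, restricted to the cases where $\bigvee_{j\in J}H_j$ is true, satisfies $\min G\le 0\le\max G$. Cooper–Calabrese iterated conditional: $(B|K)|_{C}(A|H)=B|(K\wedge(\overline{H}\vee A))$ (a conditional event). Sobocinski (quasi) conjunction: $(A|H)\wedge_{S}(B|K)=\big((AH\vee\overline{H})\wedge(BK\vee\overline{K})\big)|(H\vee K)$ (a conditional event). *)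

theory Defs
  imports Complex_Main "HOL-Library.FuncSet" "HOL-Library.Indicator_Function"
begin

text \<open>
  Events are sets of possible worlds: the type of worlds is the sure event, the empty set is the
  impossible event, and conjunction, disjunction and negation are intersection, union and
  complement.  The conditional event \<open>E\<close> given \<open>H\<close> (true on \<open>E \<inter> H\<close>, false on \<open>- E \<inter> H\<close>, void on
  \<open>- H\<close>) is represented by the pair of events; \<open>H \<noteq> {}\<close> is required in the definition of
  coherence below.
\<close>

datatype 'w cond_event = Cond (conclusion: "'w set") (antecedent: "'w set")  (infix "given" 60)

definition logically_independent4 :: "'w set \<Rightarrow> 'w set \<Rightarrow> 'w set \<Rightarrow> 'w set \<Rightarrow> bool" where
  "logically_independent4 A B H K \<longleftrightarrow>
     (\<forall>A' \<in> {A, - A}. \<forall>B' \<in> {B, - B}. \<forall>H' \<in> {H, - H}. \<forall>K' \<in> {K, - K}.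
        A' \<inter> B' \<inter> H' \<inter> K' \<noteq> {})"

definition gain ::
  "'w cond_event list \<Rightarrow> real list \<Rightarrow> nat set \<Rightarrow> (nat \<Rightarrow> real) \<Rightarrow> 'w \<Rightarrow> real" where
  "gain F P J s w =
     (\<Sum>j\<in>J. s j * indicator (antecedent (F ! j)) w * (indicator (conclusion (F ! j)) w - P ! j))"

definition gain_values ::
  "'w cond_event list \<Rightarrow> real list \<Rightarrow> nat set \<Rightarrow> (nat \<Rightarrow> real) \<Rightarrow> real set" where
  "gain_values F P J s = gain F P J s ` (\<Union>j\<in>J. antecedent (F ! j))"

text \<open>
  Even over infinitely many worlds the gain takes only finitely many values, so that the minimum
  and the maximum in the definition of coherence exist.
\<close>

lemma finite_gain_values:
  assumes "finite J"
  shows "finite (gain_values F P J s)"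
proof -
  define val where "val e = (\<Sum>j\<in>J. s j * fst (e j) * (snd (e j) - P ! j))"
    for e :: "nat \<Rightarrow> real \<times> real"
  define pat where "pat w j = (if j \<in> J then (indicator (antecedent (F ! j)) w :: real,
    indicator (conclusion (F ! j)) w :: real) else undefined)" for w j
  have "range pat \<subseteq> PiE J (\<lambda>_. {0, 1} \<times> {0, 1})"
    by (auto simp: pat_def PiE_def Pi_def extensional_def indicator_def)
  moreover have "finite (PiE J (\<lambda>_. {0, 1::real} \<times> {0, 1::real}))"
    using assms by (intro finite_PiE) auto
  ultimately have "finite (val ` range pat)"
    using finite_subset by blast
  moreover have "gain F P J s w = val (pat w)" for w
    by (simp add: gain_def val_def pat_def)
  then have "gain_values F P J s \<subseteq> val ` range pat"
    by (auto simp: gain_values_def)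
  ultimately show ?thesis
    using finite_subset by blast
qed

definition coherent :: "'w cond_event list \<Rightarrow> real list \<Rightarrow> bool" where
  "coherent F P \<longleftrightarrow>
     length P = length F \<and>
     (\<forall>j < length F. antecedent (F ! j) \<noteq> {}) \<and>
     (\<forall>J s. J \<noteq> {} \<and> J \<subseteq> {..<length F} \<longrightarrow>
        Min (gain_values F P J s) \<le> 0 \<and> 0 \<le> Max (gain_values F P J s))"

text \<open>\<open>cc_cond C D\<close> is the Cooper--Calabrese iterated conditional of \<open>C\<close> given \<open>D\<close>.\<close>

fun cc_cond :: "'w cond_event \<Rightarrow> 'w cond_event \<Rightarrow> 'w cond_event" where
  "cc_cond (B given K) (A given H) = B given (K \<inter> (- H \<union> A))"

fun sobocinski_conj :: "'w cond_event \<Rightarrow> 'w cond_event \<Rightarrow> 'w cond_event" where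
  "sobocinski_conj (A given H) (B given K) =
     (((A \<inter> H) \<union> - H) \<inter> ((B \<inter> K) \<union> - K)) given (H \<union> K)"

end

theory Submission imports Defs begin

text \<open>
  On the worlds where \<open>H \<union> K\<close> holds, each of \<open>A given H\<close> and \<open>B given K\<close> is true (t), false (f) or
  void (v), and not both are void.  Writing \<open>tf\<close> for "first true, second false", and so on, the three
  conditional events of the family take the following values (the three cases with a false first
  component agree):

    \<open>tt: 1, 1, 1\<close>;  \<open>tf: 1, 0, 0\<close>;  \<open>tv: 1, void, 1\<close>;  \<open>f*: 0, void, 0\<close>;
    \<open>vt: void, 1, 1\<close>;  \<open>vf: void, 0, 0\<close>.

  Logical independence makes every case occur, and the third conditional event is never void here.

  Necessity is the exhibition of winning bets.  One-element subfamilies force \<open>x\<close> and \<open>y\<close> into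
  the unit interval.  The stakes \<open>(- y, - 1, 1)\<close> have all gains at least \<open>x * y - z\<close>, so they would
  win surely if \<open>z < x * y\<close>; the stakes \<open>(- 1, - 1, 1)\<close> have all gains at most \<open>max x y - z\<close>, so
  they would lose surely if \<open>max x y < z\<close>.  The first are the stakes, with third
  entry \<open>1\<close>, that equalise the gains
  at \<open>tt\<close>, \<open>tf\<close> and \<open>f*\<close>, the cases that carry the probability realising \<open>z = x * y\<close>.

  Sufficiency is the exhibition of probabilities on the cases: if a probability carried by the
  union of the antecedents reproduces the prices as conditional probabilities, every gain
  has mean zero, hence can be neither always positive nor always negative
  (\<open>gain_both_signs_if_calibrated\<close>).  Three extreme probabilities reproduce \<open>x\<close> and \<open>y\<close> (trivially so where the conditional event is almost surely
  void) and have third price \<open>x * y\<close>, \<open>x\<close>, \<open>y\<close>: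
  the first puts \<open>x * y\<close>, \<open>x * (1 - y)\<close>, \<open>1 - x\<close> on \<open>tt\<close>, \<open>tf\<close>, \<open>f*\<close>; the second puts
  \<open>x\<close>, \<open>1 - x\<close> on \<open>tv\<close>, \<open>f*\<close>; the third puts \<open>y\<close>, \<open>1 - y\<close> on \<open>vt\<close>, \<open>vf\<close>.  Since the third conditional
  event is never void, its price is an affine function of the probability, so mixtures reach
  everything between \<open>x * y\<close> and \<open>max x y\<close>.  Any subfamily other than \<open>{0}\<close> and \<open>{1}\<close> has \<open>H \<union> K\<close>
  as its union of antecedents, so one probability serves for all of these; the subfamilies \<open>{0}\<close>
  and \<open>{1}\<close> use the second and the third extreme probability.
\<close>

section \<open>Sure gains and calibrated probabilities\<close>

lemma gain_values_Min_le_iff: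
  assumes "finite J" "(\<Union>j\<in>J. antecedent (F ! j)) \<noteq> {}"
  shows "Min (gain_values F P J s) \<le> c \<longleftrightarrow>
    (\<exists>w \<in> (\<Union>j\<in>J. antecedent (F ! j)). gain F P J s w \<le> c)"
  using finite_gain_values[OF assms(1), of F P s] assms(2)
  by (subst Min_le_iff) (auto simp: gain_values_def)

lemma gain_values_Max_ge_iff:
  assumes "finite J" "(\<Union>j\<in>J. antecedent (F ! j)) \<noteq> {}"
  shows "c \<le> Max (gain_values F P J s) \<longleftrightarrow>
    (\<exists>w \<in> (\<Union>j\<in>J. antecedent (F ! j)). c \<le> gain F P J s w)"
  using finite_gain_values[OF assms(1), of F P s] assms(2)
  by (subst Max_ge_iff) (auto simp: gain_values_def)

text \<open>
  The easy half of the fundamental theorem of betting: under a probability whose conditional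
  probabilities are the prices, the expected gain vanishes, so the gain cannot have a strict sign
  throughout.  The worlds are indexed, so that the weights may be listed without first showing that
  the chosen worlds are distinct.
\<close>

lemma gain_both_signs_if_calibrated:
  fixes q :: "'i \<Rightarrow> real" and w :: "'i \<Rightarrow> 'w"
  assumes "finite I" "finite J"
    and nonneg: "\<And>i. i \<in> I \<Longrightarrow> 0 \<le> q i"
    and total: "(\<Sum>i\<in>I. q i) = 1"
    and carried: "\<And>i. i \<in> I \<Longrightarrow> w i \<in> (\<Union>j\<in>J. antecedent (F ! j))"
    and calibrated: "\<And>j. j \<in> J \<Longrightarrow>
      (\<Sum>i\<in>I. q i * (indicator (antecedent (F ! j)) (w i) *
        (indicator (conclusion (F ! j)) (w i) - P ! j))) = 0"
  shows "Min (gain_values F P J s) \<le> 0 \<and> 0 \<le> Max (gain_values F P J s)"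
proof -
  have "(\<Sum>i\<in>I. q i * gain F P J s (w i)) =
      (\<Sum>i\<in>I. \<Sum>j\<in>J. s j * (q i * (indicator (antecedent (F ! j)) (w i) *
        (indicator (conclusion (F ! j)) (w i) - P ! j))))"
    by (simp add: gain_def sum_distrib_left mult_ac)
  also have "\<dots> = (\<Sum>j\<in>J. s j * (\<Sum>i\<in>I. q i * (indicator (antecedent (F ! j)) (w i) *
        (indicator (conclusion (F ! j)) (w i) - P ! j))))"
    by (subst sum.swap) (simp add: sum_distrib_left)
  also have "\<dots> = 0"
    using calibrated by simp
  finally have mean: "(\<Sum>i\<in>I. q i * gain F P J s (w i)) = 0" .
  \<comment> \<open>Some weight is positive; it rules out that all gains be positive, since their mean is \<open>0\<close>.\<close>
  obtain i0 where i0: "i0 \<in> I" "0 < q i0"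
    using total nonneg sum_nonpos[of I q] by (metis not_le zero_less_one)
  have pos: "\<exists>i\<in>I. g i \<le> 0" if "(\<Sum>i\<in>I. q i * g i) = 0" for g
  proof (rule ccontr)
    assume "\<not> ?thesis"
    then have "0 < (\<Sum>i\<in>I. q i * g i)"
      using i0 nonneg \<open>finite I\<close> by (intro sum_pos2[of I i0]) (auto simp: not_le less_imp_le)
    with that show False by simp
  qed
  have "\<exists>i\<in>I. gain F P J s (w i) \<le> 0" "\<exists>i\<in>I. 0 \<le> gain F P J s (w i)"
    using pos[of "\<lambda>i. gain F P J s (w i)"] pos[of "\<lambda>i. - gain F P J s (w i)"] mean
    by (auto simp: sum_negf)
  moreover have ne: "(\<Union>j\<in>J. antecedent (F ! j)) \<noteq> {}"
    using carried[OF i0(1)] by blast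
  ultimately show ?thesis
    unfolding gain_values_Min_le_iff[OF \<open>finite J\<close> ne] gain_values_Max_ge_iff[OF \<open>finite J\<close> ne]
    using carried by meson
qed

section \<open>Prices as mixtures, and subfamilies of three conditional events\<close>

text \<open>
  One of \<open>b\<close> and \<open>c\<close> can be taken to be \<open>0\<close>: \<open>z\<close> lies on a segment from \<open>x * y\<close> to \<open>x\<close> or from \<open>x * y\<close>
  to \<open>y\<close>.
\<close>

lemma between_product_and_max_obtains_weights:
  fixes x y z :: real
  assumes "0 \<le> x" "x \<le> 1" "0 \<le> y" "y \<le> 1" "x * y \<le> z" "z \<le> max x y"
  obtains a b c where "0 \<le> a" "0 \<le> b" "0 \<le> c" "a + b + c = 1" "z = a * (x * y) + b * x + c * y"
proof -
  have segment: "\<exists>t\<ge>0. t \<le> 1 \<and> z = (1 - t) * (x * y) + t * m" if "z \<le> m" for m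
  proof (cases "m = x * y")
    case True
    then show ?thesis
      using that assms(5) by (intro exI[of _ 0]) simp
  next
    case False
    then have "x * y < m"
      using that assms(5) by simp
    define t where "t = (z - x * y) / (m - x * y)"
    have "t * (m - x * y) = z - x * y" "0 \<le> t" "t \<le> 1"
      using \<open>x * y < m\<close> that assms(5) by (simp_all add: t_def)
    then show ?thesis
      by (intro exI[of _ t]) (simp add: algebra_simps)
  qed
  consider "z \<le> x" | "z \<le> y"
    using assms(6) by linarith
  then show thesis
  proof cases
    case 1
    then obtain t where "0 \<le> t" "t \<le> 1" "z = (1 - t) * (x * y) + t * x"
      using segment by blast
    then show thesis
      by (intro that[of "1 - t" t 0]) simp_all
  next
    case 2
    then obtain t where "0 \<le> t" "t \<le> 1" "z = (1 - t) * (x * y) + t * y"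
      using segment by blast
    then show thesis
      by (intro that[of "1 - t" 0 t]) simp_all
  qed
qed

lemma subsets_of_first_three:
  fixes J :: "nat set"
  assumes "J \<subseteq> {..<3}" "J \<noteq> {}"
  shows "J = {0} \<or> J = {1} \<or> 2 \<in> J \<or> J = {0, 1}"
proof -
  have "{..<3} = {0, 1, 2::nat}"
    by (simp add: eval_nat_numeral lessThan_Suc insert_commute)
  then have "J \<in> Pow {0, 1, 2}"
    using assms(1) by simp
  then show ?thesis
    using assms(2) unfolding Pow_insert Pow_empty by auto
qed

section \<open>Coherent prices of the iterated conditional and the quasi conjunction\<close>

theorem theorem4:
  fixes A B H K :: "'w set" and x y z :: real
  assumes "logically_independent4 A B H K"
  shows "coherent
           [A given H,
            cc_cond (B given K) (A given H),
            sobocinski_conj (A given H) (B given K)]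
           [x, y, z]
         \<longleftrightarrow> (x, y) \<in> {0..1} \<times> {0..1} \<and> z \<in> {x * y .. max x y}"
proof -
  define F where "F = [A given H, cc_cond (B given K) (A given H),
    sobocinski_conj (A given H) (B given K)]"
  define U where "U J = (\<Union>j\<in>J. antecedent (F ! j))" for J
  have ante: "antecedent (F ! 0) = H" "antecedent (F ! 1) = K \<inter> (- H \<union> A)"
    "antecedent (F ! Suc 0) = K \<inter> (- H \<union> A)" "antecedent (F ! 2) = H \<union> K"
    and concl: "conclusion (F ! 0) = A" "conclusion (F ! 1) = B" "conclusion (F ! Suc 0) = B"
    "conclusion (F ! 2) = (A \<inter> H \<union> - H) \<inter> (B \<inter> K \<union> - K)"
    and len: "length F = 3"
    by (simp_all add: F_def)
  \<comment> \<open>One world for each case; where an event does not affect the case (\<open>B\<close> in \<open>tv\<close>, say), it is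
    chosen arbitrarily.\<close>
  have "A \<inter> B \<inter> H \<inter> K \<noteq> {}" "A \<inter> - B \<inter> H \<inter> K \<noteq> {}"
    "A \<inter> B \<inter> H \<inter> - K \<noteq> {}" "- A \<inter> B \<inter> H \<inter> K \<noteq> {}"
    "A \<inter> B \<inter> - H \<inter> K \<noteq> {}" "A \<inter> - B \<inter> - H \<inter> K \<noteq> {}"
    using assms by (simp_all add: logically_independent4_def)
  then obtain tt tf tv f vt vf where
    "tt \<in> A \<inter> B \<inter> H \<inter> K" "tf \<in> A \<inter> - B \<inter> H \<inter> K"
    "tv \<in> A \<inter> B \<inter> H \<inter> - K" "f \<in> - A \<inter> B \<inter> H \<inter> K"
    "vt \<in> A \<inter> B \<inter> - H \<inter> K" "vf \<in> A \<inter> - B \<inter> - H \<inter> K"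
    unfolding ex_in_conv[symmetric] by (elim exE) (rule that)
  then have worlds [simp]:
    "tt \<in> A" "tt \<in> B" "tt \<in> H" "tt \<in> K" "tf \<in> A" "tf \<notin> B" "tf \<in> H" "tf \<in> K"
    "tv \<in> A" "tv \<in> B" "tv \<in> H" "tv \<notin> K" "f \<notin> A" "f \<in> B" "f \<in> H" "f \<in> K"
    "vt \<in> A" "vt \<in> B" "vt \<notin> H" "vt \<in> K" "vf \<in> A" "vf \<notin> B" "vf \<notin> H" "vf \<in> K"
    by auto
  have proper: "\<forall>j<length F. antecedent (F ! j) \<noteq> {}"
  proof (intro allI impI)
    fix j assume "j < length F"
    then consider "j = 0" | "j = 1" | "j = 2"
      using len by linarith
    then have "tt \<in> antecedent (F ! j)"
      by cases (simp_all add: ante)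
    then show "antecedent (F ! j) \<noteq> {}"
      by blast
  qed
  have ante_le: "antecedent (F ! j) \<subseteq> H \<union> K" if "j < 3" for j
  proof -
    consider "j = 0" | "j = 1" | "j = 2"
      using \<open>j < 3\<close> by linarith
    then show ?thesis
      by cases (auto simp: ante)
  qed
  have union_all: "U J = H \<union> K" if J: "2 \<in> J \<or> J = {0, 1}" "J \<subseteq> {..<3}" for J
  proof
    show "U J \<subseteq> H \<union> K"
      unfolding U_def using ante_le J(2) by (intro UN_least) blast
    show "H \<union> K \<subseteq> U J"
      using J(1)
    proof
      assume "2 \<in> J"
      then show ?thesis
        using ante(4) unfolding U_def by blast
    next
      assume "J = {0, 1}"
      then show ?thesis
        by (auto simp: U_def ante)
    qed
  qed
  have "coherent F [x, y, z] \<longleftrightarrow> (x, y) \<in> {0..1} \<times> {0..1} \<and> z \<in> {x * y .. max x y}"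
  proof
    assume coh: "coherent F [x, y, z]"
    have low: "\<exists>w \<in> U J. gain F [x, y, z] J s w \<le> 0"
      and high: "\<exists>w \<in> U J. 0 \<le> gain F [x, y, z] J s w"
      if J: "J \<noteq> {}" "J \<subseteq> {..<3}" for J s
    proof -
      have fin: "finite J"
        using J finite_subset by blast
      have ne: "(\<Union>j\<in>J. antecedent (F ! j)) \<noteq> {}"
      proof -
        obtain j where "j \<in> J" "j < 3"
          using J by blast
        then show ?thesis
          using proper len by auto
      qed
      have "Min (gain_values F [x, y, z] J s) \<le> 0" "0 \<le> Max (gain_values F [x, y, z] J s)"
        using coh J unfolding coherent_def len by blast+
      then show "\<exists>w \<in> U J. gain F [x, y, z] J s w \<le> 0"
        "\<exists>w \<in> U J. 0 \<le> gain F [x, y, z] J s w"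
        unfolding U_def gain_values_Min_le_iff[OF fin ne] gain_values_Max_ge_iff[OF fin ne] .
    qed
    have x: "0 \<le> x" "x \<le> 1"
      using low[of "{0}" "\<lambda>_. 1"] high[of "{0}" "\<lambda>_. 1"]
      by (auto simp: U_def gain_def ante concl indicator_def of_bool_def split: if_splits)
    have y: "0 \<le> y" "y \<le> 1"
      using low[of "{1}" "\<lambda>_. 1"] high[of "{1}" "\<lambda>_. 1"]
      by (auto simp: U_def gain_def ante concl indicator_def of_bool_def split: if_splits)
    have sum3: "sum g {..<3} = g 0 + g 1 + g 2" for g :: "nat \<Rightarrow> real"
      by (simp add: eval_nat_numeral)
    have U3: "U {..<3} = H \<union> K"
      by (rule union_all) auto
    have xy: "x * y \<le> y" "0 \<le> x * y"
      using x y by (simp_all add: mult_left_le_one_le)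
    have "x * y - z \<le> gain F [x, y, z] {..<3} (nth [- y, - 1, 1]) w" if "w \<in> H \<union> K" for w
      using that x y xy
      by (cases "w \<in> H"; cases "w \<in> K"; cases "w \<in> A"; cases "w \<in> B")
        (simp_all add: gain_def sum3 ante concl indicator_def algebra_simps)
    then have "x * y \<le> z"
      using low[of "{..<3}" "nth [- y, - 1, 1]"] U3 by fastforce
    moreover have "gain F [x, y, z] {..<3} (nth [- 1, - 1, 1]) w \<le> max x y - z"
      if "w \<in> H \<union> K" for w
      using that x y
      by (cases "w \<in> H"; cases "w \<in> K"; cases "w \<in> A"; cases "w \<in> B")
        (simp_all add: gain_def sum3 ante concl indicator_def algebra_simps max_def)
    then have "z \<le> max x y"
      using high[of "{..<3}" "nth [- 1, - 1, 1]"] U3 by fastforce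
    ultimately show "(x, y) \<in> {0..1} \<times> {0..1} \<and> z \<in> {x * y .. max x y}"
      using x y by simp
  next
    assume "(x, y) \<in> {0..1} \<times> {0..1} \<and> z \<in> {x * y .. max x y}"
    then have x: "0 \<le> x" "x \<le> 1" and y: "0 \<le> y" "y \<le> 1" and z: "x * y \<le> z" "z \<le> max x y"
      by auto
    have sum2: "sum g {..<2} = g 0 + g 1"
      and sum6: "sum g {..<6} = g 0 + g 1 + g 2 + g 3 + g 4 + g 5" for g :: "nat \<Rightarrow> real"
      by (simp_all add: eval_nat_numeral)
    have all2: "(\<forall>i<2. Q i) \<longleftrightarrow> Q 0 \<and> Q 1"
      and all6: "(\<forall>i<6. Q i) \<longleftrightarrow> Q 0 \<and> Q 1 \<and> Q 2 \<and> Q 3 \<and> Q 4 \<and> Q 5" for Q :: "nat \<Rightarrow> bool"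
    proof -
      have lt2: "i < 2 \<longleftrightarrow> i = 0 \<or> i = 1"
        and lt6: "i < 6 \<longleftrightarrow> i = 0 \<or> i = 1 \<or> i = 2 \<or> i = 3 \<or> i = 4 \<or> i = 5" for i :: nat
        by linarith+
      show "(\<forall>i<2. Q i) \<longleftrightarrow> Q 0 \<and> Q 1"
        "(\<forall>i<6. Q i) \<longleftrightarrow> Q 0 \<and> Q 1 \<and> Q 2 \<and> Q 3 \<and> Q 4 \<and> Q 5"
        unfolding lt2 lt6 by (simp_all only: imp_disjL all_conj_distrib simp_thms)
    qed
    obtain a b c where abc: "0 \<le> a" "0 \<le> b" "0 \<le> c" "a + b + c = 1"
      and zabc: "z = a * (x * y) + b * x + c * y"
      using between_product_and_max_obtains_weights x y z by blast
    have a: "a = 1 - b - c"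
      using abc by simp
    have "Min (gain_values F [x, y, z] J s) \<le> 0 \<and> 0 \<le> Max (gain_values F [x, y, z] J s)"
      if J: "J \<noteq> {}" "J \<subseteq> {..<3}" for J s
    proof -
      consider "J = {0}" | "J = {1}" | "2 \<in> J \<or> J = {0, 1}"
        using subsets_of_first_three J by blast
      then show ?thesis
      proof cases
        case 1
        define q where "q = nth [x, 1 - x]"
        define w where "w = nth [tv, f]"
        have "\<forall>i<2. 0 \<le> q i" "\<forall>i<2. w i \<in> U J" "sum q {..<2} = 1"
          unfolding all2 sum2 using x by (simp_all add: q_def w_def 1 U_def ante)
        then show ?thesis
          by (intro gain_both_signs_if_calibrated[of "{..<2}" J q w])
            (auto simp: U_def 1 sum2 q_def w_def ante concl algebra_simps)
      next
        case 2
        define q where "q = nth [y, 1 - y]"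
        define w where "w = nth [vt, vf]"
        have "\<forall>i<2. 0 \<le> q i" "\<forall>i<2. w i \<in> U J" "sum q {..<2} = 1"
          unfolding all2 sum2 using y by (simp_all add: q_def w_def 2 U_def ante)
        then show ?thesis
          by (intro gain_both_signs_if_calibrated[of "{..<2}" J q w])
            (auto simp: U_def 2 sum2 q_def w_def ante concl algebra_simps)
      next
        case 3
        \<comment> \<open>the mixture, with coefficients \<open>a, b, c\<close>, of the three extreme probabilities\<close>
        define q where "q = nth [a * (x * y), a * (x * (1 - y)), b * x, (a + b) * (1 - x),
          c * y, c * (1 - y)]"
        define w where "w = nth [tt, tf, tv, f, vt, vf]"
        have q: "\<forall>i<6. 0 \<le> q i"
          unfolding all6 using x y abc by (simp add: q_def)
        have w: "\<forall>i<6. w i \<in> U J"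
          unfolding all6 union_all[OF 3 J(2)] by (simp add: w_def)
        have total: "sum q {..<6} = 1"
          unfolding sum6 by (simp add: q_def a algebra_simps)
        have calibrated: "(\<Sum>i<6. q i * (indicator (antecedent (F ! j)) (w i) *
            (indicator (conclusion (F ! j)) (w i) - [x, y, z] ! j))) = 0" if "j \<in> J" for j
        proof -
          have "j < 3"
            using that J(2) by blast
          then consider "j = 0" | "j = 1" | "j = 2"
            by linarith
          then show ?thesis
            by cases (simp_all add: sum6 q_def w_def ante concl zabc a algebra_simps)
        qed
        show ?thesis
          using q w total calibrated finite_subset[OF J(2)]
          by (intro gain_both_signs_if_calibrated[of "{..<6}" J q w]) (auto simp: U_def)
      qed
    qed
    then show "coherent F [x, y, z]"
      using proper by (simp add: coherent_def len)
  qed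
  then show ?thesis
    by (simp only: F_def)
qed

end
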